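(* Let $p$ be an AHI polynomial in $n$ variables that is non-negative on $\mathbb{R}^n$, and let $2D$ be an even integer with $\deg p\le 2D$. Then $p$ lies in the SONC cone $\mathcal{C}_{n,2D}$.
   Context: AHI polynomials: a polynomial in $n$ variables is an AHI polynomial if it has the form $p(x)=\big(\sum_{i=1}^n \lambda_i x^{\alpha(i)}\big)\big(\sum_{i=1}^n \lambda_i \prod_{j\neq i} x^{\alpha(j)}\big)-c\prod_{i=1}^n x^{\alpha(i)}$ with $\lambda_i\ge 0$, $c\in\mathbb{R}$, and each $x^{\alpha(i)}$ a squared monomial in $x_1,\dots,x_n$ (all exponents even non-negative integers). Circuit polynomials: a circuit polynomial is a polynomial $g=\sum_{j=0}^m b_jx^{a(j)}+c'x^{y}$ where $a(0),\dots,a(m)\in(2\mathbb{Z}_{\ge0})^n$ are affinely independent, $b_j>0$, $c'\in\mathbb{R}$, and $y\in\mathbb{Z}_{\ge 0}^n$ lies in the relative interior of the simplex $\operatorname{conv}\{a(0),\dots,a(m)\}$ (so $y=\sum_j\nu_ja(j)$ with $\nu_j>0$, $\sum_j\nu_j=1$); monomial squares $b\,x^{a}$ with $b>0$, $a\in(2\mathbb{Z}_{\ge0})^n$ are included as a degenerate case. The SONC cone $\mathcal{C}_{n,2D}$ is the set of finite non-negative linear combinations of circuit polynomials in $n$ variables of degree at most $2D$ that are non-negative on $\mathbb{R}^n$. *)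

theory Defs
  imports "HOL-Analysis.Analysis" "HOL-Library.Poly_Mapping"
begin

text \<open>
  A real polynomial in \<open>n = CARD('n)\<close> variables is a finitely supported map from exponent
  vectors to coefficients; the product on this type is the convolution product, and
  \<open>Poly_Mapping.single a b\<close> is the term $b\,x^a$ (so \<open>Poly_Mapping.single 0 b\<close> is the
  constant $b$).
\<close>

type_synonym 'n rpoly = "(nat ^ 'n) \<Rightarrow>\<^sub>0 real"

definition peval :: "'n::finite rpoly \<Rightarrow> real ^ 'n \<Rightarrow> real" where
  "peval p x = (\<Sum>a\<in>Poly_Mapping.keys p. Poly_Mapping.lookup p a * (\<Prod>i\<in>UNIV. (x $ i) ^ (a $ i)))"

text \<open>Total degree; by convention the zero polynomial has degree \<open>0\<close>.\<close>

definition total_degree :: "'n::finite rpoly \<Rightarrow> nat" where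
  "total_degree p = Max (insert 0 ((\<lambda>a. \<Sum>i\<in>UNIV. a $ i) ` Poly_Mapping.keys p))"

definition nonneg_poly :: "'n::finite rpoly \<Rightarrow> bool" where
  "nonneg_poly p \<longleftrightarrow> (\<forall>x :: real ^ 'n. 0 \<le> peval p x)"

definition even_exponent :: "nat ^ 'n::finite \<Rightarrow> bool" where
  "even_exponent a \<longleftrightarrow> (\<forall>i. even (a $ i))"

definition real_exponent :: "nat ^ 'n::finite \<Rightarrow> real ^ 'n" where
  "real_exponent a = (\<chi> i. real (a $ i))"

text \<open>The same \<open>n\<close> is the number of variables and the number of monomials \<open>\<alpha> i\<close>, which need
  not be distinct.\<close>

definition AHI_poly :: "'n::finite rpoly \<Rightarrow> bool" where
  "AHI_poly p \<longleftrightarrow> (\<exists>(l :: 'n \<Rightarrow> real) (c :: real) (\<alpha> :: 'n \<Rightarrow> nat ^ 'n).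
     (\<forall>i. 0 \<le> l i) \<and> (\<forall>i. even_exponent (\<alpha> i)) \<and>
     p = (\<Sum>i\<in>UNIV. Poly_Mapping.single 0 (l i) * Poly_Mapping.single (\<alpha> i) 1) *
         (\<Sum>i\<in>UNIV. Poly_Mapping.single 0 (l i) * (\<Prod>j\<in>UNIV - {i}. Poly_Mapping.single (\<alpha> j) 1)) -
         Poly_Mapping.single 0 c * (\<Prod>i\<in>UNIV. Poly_Mapping.single (\<alpha> i) 1))"

text \<open>Since \<^const>\<open>affine_dependent\<close> is a predicate on sets, affine independence of the
  family \<open>a 0, \<dots>, a m\<close> also needs injectivity.\<close>

definition circuit_poly :: "'n::finite rpoly \<Rightarrow> bool" where
  "circuit_poly g \<longleftrightarrow>
     (\<exists>(m :: nat) (a :: nat \<Rightarrow> nat ^ 'n) (b :: nat \<Rightarrow> real) (c' :: real) (y :: nat ^ 'n).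
        (\<forall>j\<le>m. even_exponent (a j) \<and> 0 < b j) \<and>
        inj_on a {..m} \<and> \<not> affine_dependent (real_exponent ` a ` {..m}) \<and>
        real_exponent y \<in> rel_interior (convex hull (real_exponent ` a ` {..m})) \<and>
        g = (\<Sum>j\<le>m. Poly_Mapping.single (a j) (b j)) + Poly_Mapping.single y c') \<or>
     (\<exists>(a :: nat ^ 'n) (b :: real). even_exponent a \<and> 0 < b \<and> g = Poly_Mapping.single a b)"

text \<open>\<open>N = 0\<close> is the empty combination, so the zero polynomial belongs to the cone.\<close>

definition SONC_cone :: "nat \<Rightarrow> 'n::finite rpoly set" where
  "SONC_cone d = {p. \<exists>(N :: nat) (\<mu> :: nat \<Rightarrow> real) (g :: nat \<Rightarrow> 'n rpoly).
     (\<forall>k<N. 0 \<le> \<mu> k \<and> circuit_poly (g k) \<and> total_degree (g k) \<le> d \<and> nonneg_poly (g k)) \<and>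
     p = (\<Sum>k<N. Poly_Mapping.single 0 (\<mu> k) * g k)}"

end

theory Submission
  imports Defs
begin

text \<open>
  Let \<open>x\<^sup>A\<close> be the product of all the monomials \<open>x\<^bsup>\<alpha>(i)\<^esup>\<close>. When the product of the two
  sums is expanded, the pair \<open>(i, j)\<close> contributes \<open>\<lambda>\<^sub>i \<lambda>\<^sub>j x\<^bsup>u(i,j)\<^esup>\<close>, where \<open>u i j = A + \<alpha> i - \<alpha> j\<close>.
  The exponents \<open>u i j\<close> and \<open>u j i\<close> are even and have midpoint \<open>A\<close>, so symmetrising over ordered pairs gives
  \[ p = \sum_{i,j} \frac{\lambda_i\lambda_j}{2}\,(x^{u(i,j)} + x^{u(j,i)} - 2x^A)
       + \Bigl(\bigl(\sum_i\lambda_i\bigr)^2 - c\Bigr)\,x^A . \]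
  A bracket either vanishes (when \<open>u i j = A\<close>) or is a circuit polynomial supported on a segment and
  its midpoint; it is non-negative because it is the square of a binomial
  (\<open>nonneg_midpoint_binomial\<close>, \<open>circuit_midpoint_binomial\<close>). All brackets vanish at the point
  \<open>(1, \<dots>, 1)\<close>, so the non-negativity of \<open>p\<close> there says exactly that the last
  coefficient is non-negative, and the last term is a monomial square.

  The degree bound on the pieces holds because nothing relevant cancels in \<open>p\<close>: away from \<open>A\<close> all
  coefficients of \<open>p\<close> are sums of products \<open>\<lambda>\<^sub>i \<lambda>\<^sub>j \<ge> 0\<close>, so every \<open>u i j\<close> that matters is an
  exponent of \<open>p\<close>. The degree of \<open>A\<close> is the mean of the degrees of \<open>u i j\<close> and \<open>u j i\<close>; if no bracket
  survives, then \<open>p\<close> is a multiple of \<open>x\<^sup>A\<close> itself.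
\<close>

section \<open>Evaluation and degree\<close>

abbreviation monomial_at :: "real ^ 'n::finite \<Rightarrow> nat ^ 'n \<Rightarrow> real" where
  "monomial_at x a \<equiv> (\<Prod>i\<in>UNIV. (x $ i) ^ (a $ i))"

abbreviation exponent_degree :: "nat ^ 'n::finite \<Rightarrow> nat" where
  "exponent_degree a \<equiv> (\<Sum>i\<in>UNIV. a $ i)"

lemma peval_superset:
  assumes "finite S" "Poly_Mapping.keys p \<subseteq> S"
  shows "peval p x = (\<Sum>a\<in>S. Poly_Mapping.lookup p a * monomial_at x a)"
  unfolding peval_def
  by (rule sum.mono_neutral_left) (use assms in \<open>auto simp: in_keys_iff\<close>)

lemma peval_single [simp]: "peval (Poly_Mapping.single a b) x = b * monomial_at x a"
  by (subst peval_superset[of "{a}"]) auto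

lemma peval_zero [simp]: "peval 0 x = 0"
  by (simp add: peval_def)

lemma peval_add [simp]: "peval (p + q) x = peval p x + peval q x"
proof -
  let ?S = "Poly_Mapping.keys p \<union> Poly_Mapping.keys q"
  have "peval r x = (\<Sum>a\<in>?S. Poly_Mapping.lookup r a * monomial_at x a)"
    if "Poly_Mapping.keys r \<subseteq> ?S" for r
    using that by (intro peval_superset) auto
  from this[of p] this[of q] this[OF keys_add] show ?thesis
    by (simp add: lookup_add algebra_simps sum.distrib)
qed

lemma peval_sum: "peval (\<Sum>i\<in>I. f i) x = (\<Sum>i\<in>I. peval (f i) x)"
  by (induction I rule: infinite_finite_induct) auto

lemma total_degree_leI:
  assumes "\<And>a. a \<in> Poly_Mapping.keys p \<Longrightarrow> exponent_degree a \<le> d"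
  shows "total_degree p \<le> d"
  unfolding total_degree_def using assms by (subst Max_le_iff) auto

lemma exponent_degree_le_total_degree:
  assumes "a \<in> Poly_Mapping.keys p"
  shows "exponent_degree a \<le> total_degree p"
  unfolding total_degree_def using assms by (intro Max_ge) auto

section \<open>Circuit polynomials supported on a segment and its midpoint\<close>

definition midpoint_binomial :: "nat ^ 'n::finite \<Rightarrow> nat ^ 'n \<Rightarrow> nat ^ 'n \<Rightarrow> 'n rpoly" where
  "midpoint_binomial u v w =
     Poly_Mapping.single u 1 + Poly_Mapping.single v 1 + Poly_Mapping.single w (- 2)"

text \<open>With \<open>u = 2r\<close> and \<open>v = 2s\<close> the midpoint is \<open>w = r + s\<close>, so the polynomial is
  \<open>(x\<^sup>r - x\<^sup>s)\<^sup>2\<close>.\<close>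

lemma nonneg_midpoint_binomial:
  assumes "even_exponent u" "even_exponent v" and mid: "u + v = w + w"
  shows "nonneg_poly (midpoint_binomial u v w)"
  unfolding nonneg_poly_def
proof
  fix x :: "real ^ 'a"
  define r where "r = (\<Prod>i\<in>UNIV. (x $ i) ^ (u $ i div 2))"
  define s where "s = (\<Prod>i\<in>UNIV. (x $ i) ^ (v $ i div 2))"
  have w: "w $ i = u $ i div 2 + v $ i div 2" for i
  proof -
    have "u $ i + v $ i = w $ i + w $ i"
      using mid by (metis vector_add_component)
    moreover have "even (u $ i)" "even (v $ i)"
      using assms by (auto simp: even_exponent_def)
    ultimately show ?thesis by presburger
  qed
  have square: "monomial_at x z = (\<Prod>i\<in>UNIV. (x $ i) ^ (z $ i div 2)) ^ 2"
    if "even_exponent z" for z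
    unfolding prod_power_distrib using that
    by (intro prod.cong) (auto simp: even_exponent_def simp flip: power_mult)
  have "monomial_at x u = r ^ 2" "monomial_at x v = s ^ 2"
    unfolding r_def s_def by (rule assms(1,2)[THEN square])+
  moreover have "monomial_at x w = r * s"
    by (simp add: r_def s_def w power_add prod.distrib)
  ultimately have "peval (midpoint_binomial u v w) x = (r - s) ^ 2"
    by (simp add: midpoint_binomial_def power2_eq_square algebra_simps)
  then show "0 \<le> peval (midpoint_binomial u v w) x"
    by simp
qed

lemma circuit_midpoint_binomial:
  assumes "even_exponent u" "even_exponent v" and mid: "u + v = w + w" and "u \<noteq> v"
  shows "circuit_poly (midpoint_binomial u v w)"
proof -
  define a where "a = (\<lambda>j::nat. if j = 0 then u else v)"
  have atMost1: "{..1::nat} = {0, 1}" by auto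
  have img: "real_exponent ` a ` {..1} = {real_exponent u, real_exponent v}"
    unfolding atMost1 by (auto simp: a_def)
  have neq: "real_exponent u \<noteq> real_exponent v"
    using \<open>u \<noteq> v\<close> by (auto simp: real_exponent_def vec_eq_iff)
  have "real_exponent w = midpoint (real_exponent u) (real_exponent v)"
  proof -
    have "real (u $ i) + real (v $ i) = 2 * real (w $ i)" for i
      using arg_cong[OF mid, of "\<lambda>z. real (z $ i)"] by simp
    then show ?thesis
      by (simp add: vec_eq_iff real_exponent_def midpoint_def)
  qed
  then have "real_exponent w \<in> rel_interior (convex hull (real_exponent ` a ` {..1}))"
    using neq unfolding img by (simp add: rel_interior_closed_segment flip: segment_convex_hull)
  moreover have "midpoint_binomial u v w =
      (\<Sum>j\<le>1. Poly_Mapping.single (a j) 1) + Poly_Mapping.single w (- 2)"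
    unfolding atMost1 by (simp add: a_def midpoint_binomial_def)
  moreover have "inj_on a {..1}" "\<forall>j\<le>1. even_exponent (a j) \<and> (0::real) < 1"
    using assms unfolding atMost1 by (auto simp: a_def)
  moreover have "\<not> affine_dependent (real_exponent ` a ` {..1})"
    unfolding img by (rule affine_independent_2)
  ultimately show ?thesis
    unfolding circuit_poly_def
    by - (rule disjI1, rule exI[of _ 1], rule exI[of _ a], rule exI[of _ "\<lambda>_. 1"],
        rule exI[of _ "- 2"], rule exI[of _ w], intro conjI; assumption)
qed

text \<open>Degree is additive in the exponent, so \<open>w\<close> has the mean of the degrees of \<open>u\<close> and \<open>v\<close>.\<close>

lemma degree_midpoint_le:
  assumes "u + v = w + w" "exponent_degree u \<le> d" "exponent_degree v \<le> d"
  shows "exponent_degree w \<le> d"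
proof -
  have "exponent_degree u + exponent_degree v = exponent_degree w + exponent_degree w"
    using arg_cong[OF assms(1), of exponent_degree] by (simp add: sum.distrib)
  with assms(2,3) show ?thesis by linarith
qed

lemma total_degree_midpoint_binomial_le:
  assumes "exponent_degree u \<le> d" "exponent_degree v \<le> d" "exponent_degree w \<le> d"
  shows "total_degree (midpoint_binomial u v w) \<le> d"
proof (rule total_degree_leI)
  fix a assume "a \<in> Poly_Mapping.keys (midpoint_binomial u v w)"
  then have "a \<in> {u, v, w}"
    by (auto simp: midpoint_binomial_def in_keys_iff lookup_add lookup_single when_def
             split: if_splits)
  with assms show "exponent_degree a \<le> d" by auto
qed

section \<open>The SONC cone\<close>

lemma SONC_cone_zero: "0 \<in> SONC_cone d"
  unfolding SONC_cone_def by (auto intro!: exI[of _ "0::nat"])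

lemma SONC_cone_add_circuit:
  fixes f h :: "'n::finite rpoly"
  assumes "f \<in> SONC_cone d" "0 \<le> r" "circuit_poly h" "total_degree h \<le> d" "nonneg_poly h"
  shows "f + Poly_Mapping.single 0 r * h \<in> SONC_cone d"
proof -
  obtain N :: nat and \<mu> :: "nat \<Rightarrow> real" and g :: "nat \<Rightarrow> 'n rpoly" where
    g: "\<forall>k<N. 0 \<le> \<mu> k \<and> circuit_poly (g k) \<and> total_degree (g k) \<le> d \<and> nonneg_poly (g k)"
    and f: "f = (\<Sum>k<N. Poly_Mapping.single 0 (\<mu> k) * g k)"
    using assms(1) by (auto simp: SONC_cone_def)
  let ?\<mu> = "\<mu>(N := r)" and ?g = "g(N := h)"
  have "\<forall>k<Suc N. 0 \<le> ?\<mu> k \<and> circuit_poly (?g k) \<and> total_degree (?g k) \<le> d \<and> nonneg_poly (?g k)"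
    using g assms(2-) by (simp add: less_Suc_eq)
  moreover have "f + Poly_Mapping.single 0 r * h = (\<Sum>k<Suc N. Poly_Mapping.single 0 (?\<mu> k) * ?g k)"
    by (simp add: f)
  ultimately show ?thesis
    unfolding SONC_cone_def
    by - (rule CollectI, rule exI[of _ "Suc N"], rule exI[of _ ?\<mu>], rule exI[of _ ?g], rule conjI)
qed

text \<open>Vanishing weights and vanishing summands are admitted so that the lemma applies to a family over
  all pairs of indices: the binomials that enter with weight zero can have arbitrarily large
  degree, and a pair with equal endpoints gives the zero polynomial.\<close>

lemma SONC_cone_add_circuit_sum:
  assumes "finite I" "f \<in> SONC_cone d"
    and "\<And>i. i \<in> I \<Longrightarrow> 0 \<le> \<mu> i"
    and "\<And>i. i \<in> I \<Longrightarrow> \<mu> i = 0 \<or> h i = 0 \<or>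
           circuit_poly (h i) \<and> total_degree (h i) \<le> d \<and> nonneg_poly (h i)"
  shows "f + (\<Sum>i\<in>I. Poly_Mapping.single 0 (\<mu> i) * h i) \<in> SONC_cone d"
  using assms(1,3,4)
proof (induction I rule: finite_induct)
  case empty
  then show ?case using assms(2) by simp
next
  case (insert i I)
  let ?F = "f + (\<Sum>i\<in>I. Poly_Mapping.single 0 (\<mu> i) * h i)"
  have "?F + Poly_Mapping.single 0 (\<mu> i) * h i \<in> SONC_cone d"
  proof -
    have F: "?F \<in> SONC_cone d"
      using insert.prems by (intro insert.IH) auto
    consider "\<mu> i = 0 \<or> h i = 0"
      | "circuit_poly (h i)" "total_degree (h i) \<le> d" "nonneg_poly (h i)"
      using insert.prems(2)[of i] by blast
    then show ?thesis
    proof cases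
      case 1
      with F show ?thesis by auto
    next
      case 2
      with F insert.prems(1)[of i] show ?thesis by (intro SONC_cone_add_circuit) auto
    qed
  qed
  then show ?case
    using insert.hyps by (simp add: ac_simps)
qed

lemma SONC_cone_monomial_square:
  assumes "even_exponent a" "0 \<le> b" "b \<noteq> 0 \<Longrightarrow> exponent_degree a \<le> d"
  shows "Poly_Mapping.single a b \<in> SONC_cone d"
proof (cases "b = 0")
  case True
  then show ?thesis by (simp add: SONC_cone_zero)
next
  case False
  let ?h = "Poly_Mapping.single a (1::real)"
  have "circuit_poly ?h"
    unfolding circuit_poly_def using assms(1) by (intro disjI2 exI[of _ a] exI[of _ 1]) auto
  moreover have "total_degree ?h \<le> d"
    using False assms(3) by (intro total_degree_leI) auto
  moreover have "nonneg_poly ?h"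
    using assms(1) by (auto simp: nonneg_poly_def even_exponent_def zero_le_even_power intro!: prod_nonneg)
  ultimately have "0 + Poly_Mapping.single 0 b * ?h \<in> SONC_cone d"
    using assms(2) by (intro SONC_cone_add_circuit SONC_cone_zero)
  then show ?thesis by (simp add: mult_single)
qed

section \<open>Decomposition of AHI polynomials\<close>

lemma prod_single_one:
  "(\<Prod>j\<in>J. Poly_Mapping.single (\<alpha> j) 1) = Poly_Mapping.single (\<Sum>j\<in>J. \<alpha> j :: nat ^ 'n::finite) (1::real)"
proof (induction J rule: infinite_finite_induct)
  case (insert j J)
  then show ?case by (simp add: mult_single)
qed simp_all

text \<open>The exponent \<open>A + \<alpha> i - \<alpha> j\<close>, where \<open>A\<close> is the sum of all \<open>\<alpha> k\<close>, written without
  subtraction.\<close>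

definition swap_exponent :: "('n::finite \<Rightarrow> nat ^ 'n) \<Rightarrow> 'n \<Rightarrow> 'n \<Rightarrow> nat ^ 'n" where
  "swap_exponent \<alpha> i j = \<alpha> i + (\<Sum>k\<in>UNIV - {j}. \<alpha> k)"

lemma swap_exponent_midpoint:
  "swap_exponent \<alpha> i j + swap_exponent \<alpha> j i = (\<Sum>k\<in>UNIV. \<alpha> k) + (\<Sum>k\<in>UNIV. \<alpha> k)"
proof -
  have A: "(\<Sum>k\<in>UNIV. \<alpha> k) = \<alpha> m + (\<Sum>k\<in>UNIV - {m}. \<alpha> k)" for m
    by (rule sum.remove) auto
  have "swap_exponent \<alpha> i j + swap_exponent \<alpha> j i =
      (\<alpha> j + (\<Sum>k\<in>UNIV - {j}. \<alpha> k)) + (\<alpha> i + (\<Sum>k\<in>UNIV - {i}. \<alpha> k))"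
    unfolding swap_exponent_def by (simp only: ac_simps)
  then show ?thesis
    by (simp only: flip: A)
qed

lemma even_exponent_sum:
  assumes "\<And>k. k \<in> K \<Longrightarrow> even_exponent (\<alpha> k)"
  shows "even_exponent (\<Sum>k\<in>K. \<alpha> k)"
  using assms by (auto simp: even_exponent_def intro!: dvd_sum)

lemma even_swap_exponent:
  assumes "\<And>k. even_exponent (\<alpha> k)"
  shows "even_exponent (swap_exponent \<alpha> i j)"
  using even_exponent_sum[of "UNIV - {j}" \<alpha>] assms
  by (auto simp: swap_exponent_def even_exponent_def)

lemma AHI_expansion:
  fixes \<alpha> :: "'n::finite \<Rightarrow> nat ^ 'n"
  shows "(\<Sum>i\<in>UNIV. Poly_Mapping.single 0 (l i) * Poly_Mapping.single (\<alpha> i) 1) *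
         (\<Sum>i\<in>UNIV. Poly_Mapping.single 0 (l i) * (\<Prod>j\<in>UNIV - {i}. Poly_Mapping.single (\<alpha> j) 1)) -
         Poly_Mapping.single 0 c * (\<Prod>i\<in>UNIV. Poly_Mapping.single (\<alpha> i) 1) =
         (\<Sum>(i, j)\<in>UNIV. Poly_Mapping.single (swap_exponent \<alpha> i j) (l i * l j :: real)) -
         Poly_Mapping.single (\<Sum>k\<in>UNIV. \<alpha> k) c"
  by (simp add: prod_single_one mult_single sum_product swap_exponent_def sum.cartesian_product)

lemma sum_single: "(\<Sum>i\<in>I. Poly_Mapping.single a (f i)) = Poly_Mapping.single a (\<Sum>i\<in>I. f i)"
  by (induction I rule: infinite_finite_induct) (auto simp: single_add)

text \<open>Adding and subtracting the weights \<open>w i j\<close> at the midpoint turns a sum of monomials with symmetric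
  weights into a sum of midpoint binomials, one half from each of the ordered pairs \<open>(i, j)\<close> and
  \<open>(j, i)\<close>.\<close>

lemma sum_single_symmetrize:
  fixes w :: "'i::finite \<Rightarrow> 'i \<Rightarrow> real"
  assumes sym: "\<And>i j. w i j = w j i"
  shows "(\<Sum>(i, j)\<in>UNIV. Poly_Mapping.single (u i j) (w i j)) =
         Poly_Mapping.single A (\<Sum>(i, j)\<in>UNIV. w i j) +
         (\<Sum>(i, j)\<in>UNIV. Poly_Mapping.single 0 (w i j / 2) * midpoint_binomial (u i j) (u j i) A)"
proof -
  let ?h = "\<lambda>i j. Poly_Mapping.single (u i j) (w i j / 2)"
  have swap: "(\<Sum>(i, j)\<in>UNIV. ?h j i) = (\<Sum>(i, j)\<in>UNIV. ?h i j)"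
    by (rule sum.reindex_bij_witness[of _ prod.swap prod.swap]) auto
  have "(\<Sum>(i, j)\<in>UNIV. Poly_Mapping.single 0 (w i j / 2) * midpoint_binomial (u i j) (u j i) A) =
        (\<Sum>(i, j)\<in>UNIV. ?h i j + ?h j i - Poly_Mapping.single A (w i j))"
    by (intro sum.cong refl)
       (auto simp: midpoint_binomial_def distrib_left right_diff_distrib mult_single single_uminus sym)
  also have "\<dots> = (\<Sum>(i, j)\<in>UNIV. ?h i j) + (\<Sum>(i, j)\<in>UNIV. ?h j i) -
                 Poly_Mapping.single A (\<Sum>(i, j)\<in>UNIV. w i j)"
    by (simp add: case_prod_unfold sum.distrib sum_subtractf sum_single)
  also have "(\<Sum>(i, j)\<in>UNIV. ?h i j) + (\<Sum>(i, j)\<in>UNIV. ?h j i) =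
             (\<Sum>(i, j)\<in>UNIV. Poly_Mapping.single (u i j) (w i j))"
    unfolding swap by (simp add: case_prod_unfold flip: sum.distrib single_add)
  finally show ?thesis by simp
qed

theorem proposition4p1:
  fixes p :: "'n::finite rpoly" and D :: nat
  assumes "AHI_poly p"
    and "nonneg_poly p"
    and "total_degree p \<le> 2 * D"
  shows "p \<in> SONC_cone (2 * D)"
proof -
  obtain l :: "'n \<Rightarrow> real" and c :: real and \<alpha> :: "'n \<Rightarrow> nat ^ 'n" where
    l: "\<And>i. 0 \<le> l i" and even: "\<And>i. even_exponent (\<alpha> i)" and
    p0: "p = (\<Sum>i\<in>UNIV. Poly_Mapping.single 0 (l i) * Poly_Mapping.single (\<alpha> i) 1) *
         (\<Sum>i\<in>UNIV. Poly_Mapping.single 0 (l i) * (\<Prod>j\<in>UNIV - {i}. Poly_Mapping.single (\<alpha> j) 1)) -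
         Poly_Mapping.single 0 c * (\<Prod>i\<in>UNIV. Poly_Mapping.single (\<alpha> i) 1)"
    using assms(1) unfolding AHI_poly_def by blast
  define A where "A = (\<Sum>k\<in>UNIV. \<alpha> k)"
  define u where "u = swap_exponent \<alpha>"
  define h where "h = (\<lambda>(i, j). midpoint_binomial (u i j) (u j i) A)"
  define \<mu> where "\<mu> = (\<lambda>(i, j). l i * l j / 2)"
  define b where "b = (\<Sum>(i, j)\<in>UNIV. l i * l j) - c"
  have mid: "u i j + u j i = A + A" for i j
    unfolding u_def A_def by (rule swap_exponent_midpoint)
  have even_u: "even_exponent (u i j)" for i j
    unfolding u_def using even by (rule even_swap_exponent)
  have even_A: "even_exponent A"
    unfolding A_def using even by (intro even_exponent_sum)
  have expansion: "p = (\<Sum>(i, j)\<in>UNIV. Poly_Mapping.single (u i j) (l i * l j)) -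
      Poly_Mapping.single A c"
    unfolding p0 u_def A_def by (rule AHI_expansion)
  have decomposition: "p = Poly_Mapping.single A b +
      (\<Sum>ij\<in>UNIV. Poly_Mapping.single 0 (\<mu> ij) * h ij)"
    unfolding expansion b_def \<mu>_def h_def
    by (subst sum_single_symmetrize[of "\<lambda>i j. l i * l j" u A])
       (auto simp: single_diff case_prod_unfold)

  have "0 \<le> peval p 1"
    using assms(2) by (simp add: nonneg_poly_def)
  also have "peval p 1 = b"
  proof -
    have "peval (Poly_Mapping.single 0 (\<mu> ij) * h ij) 1 = 0" for ij
      by (cases ij) (simp add: h_def midpoint_binomial_def distrib_left mult_single)
    then show ?thesis
      unfolding decomposition by (simp add: peval_sum)
  qed
  finally have b: "0 \<le> b" .

  \<comment> \<open>Only the exponent \<open>A\<close> receives a possibly negative coefficient, so no other monomial of the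
     expansion cancels.\<close>
  have degree_u: "exponent_degree (u i j) \<le> 2 * D" if "l i * l j \<noteq> 0" "u i j \<noteq> A" for i j
  proof -
    have "0 < l i * l j"
      using that(1) l[of i] l[of j] by (simp add: order_less_le)
    also have "l i * l j \<le> (\<Sum>(i', j')\<in>UNIV. if u i' j' = u i j then l i' * l j' else 0)"
      using member_le_sum[of "(i, j)" UNIV "\<lambda>(i', j'). if u i' j' = u i j then l i' * l j' else 0"]
      by (auto simp: l)
    also have "\<dots> = Poly_Mapping.lookup p (u i j)"
      using that(2)
      by (auto simp: expansion lookup_minus lookup_sum lookup_single when_def case_prod_unfold
          intro!: sum.cong)
    finally have "u i j \<in> Poly_Mapping.keys p"
      by (simp add: in_keys_iff)
    then show ?thesis
      using exponent_degree_le_total_degree[of _ p] assms(3) by (blast intro: order_trans)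
  qed

  have u_swap: "u j i \<noteq> A" "u j i \<noteq> u i j" if "u i j \<noteq> A" for i j
  proof -
    show "u j i \<noteq> A"
      using mid[of i j] that by auto
    show "u j i \<noteq> u i j"
    proof
      assume "u j i = u i j"
      then have "u i j $ k + u i j $ k = A $ k + A $ k" for k
        using mid[of i j] by (metis vector_add_component)
      then have "u i j $ k = A $ k" for k
        by (metis add_self_div_2)
      with that show False by (simp add: vec_eq_iff)
    qed
  qed

  have degree_A: "exponent_degree A \<le> 2 * D" if "l i * l j \<noteq> 0" "u i j \<noteq> A" for i j
    using that u_swap[of i j] degree_u[of i j] degree_u[of j i]
    by (intro degree_midpoint_le[OF mid[of i j]]) (auto simp: mult.commute)

  have h_zero: "h (i, j) = 0" if "u i j = A" for i j
  proof -
    have "u j i = A"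
      using mid[of i j] that by simp
    then show ?thesis
      using that by (simp add: h_def midpoint_binomial_def flip: single_add)
  qed

  have "exponent_degree A \<le> 2 * D" if "b \<noteq> 0"
  proof (cases "\<exists>i j. l i * l j \<noteq> 0 \<and> u i j \<noteq> A")
    case True
    then show ?thesis using degree_A by blast
  next
    case False
    have "Poly_Mapping.single 0 (\<mu> (i, j)) * h (i, j) = 0" for i j
    proof (cases "u i j = A")
      case True
      then show ?thesis by (simp add: h_zero)
    next
      case nontrivial: False
      with False have "\<mu> (i, j) = 0" by (auto simp: \<mu>_def)
      then show ?thesis by simp
    qed
    then have "Poly_Mapping.single 0 (\<mu> ij) * h ij = 0" for ij
      by (cases ij) simp
    then have "p = Poly_Mapping.single A b"
      using decomposition by simp
    then have "A \<in> Poly_Mapping.keys p"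
      using that by simp
    then show ?thesis
      using exponent_degree_le_total_degree[of _ p] assms(3) by (blast intro: order_trans)
  qed
  then have square: "Poly_Mapping.single A b \<in> SONC_cone (2 * D)"
    using even_A b by (intro SONC_cone_monomial_square)
  have pieces: "\<mu> (i, j) = 0 \<or> h (i, j) = 0 \<or>
      circuit_poly (h (i, j)) \<and> total_degree (h (i, j)) \<le> 2 * D \<and> nonneg_poly (h (i, j))" for i j
  proof (cases "l i * l j \<noteq> 0 \<and> u i j \<noteq> A")
    case True
    then have "circuit_poly (h (i, j))"
      using u_swap[of i j] mid even_u by (auto simp: h_def intro!: circuit_midpoint_binomial)
    moreover have "nonneg_poly (h (i, j))"
      using mid even_u by (auto simp: h_def intro!: nonneg_midpoint_binomial)
    moreover have "total_degree (h (i, j)) \<le> 2 * D"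
      using True u_swap[of i j] degree_u[of i j] degree_u[of j i] degree_A[of i j]
      by (auto simp: h_def mult.commute intro!: total_degree_midpoint_binomial_le)
    ultimately show ?thesis by blast
  qed (use h_zero in \<open>auto simp: \<mu>_def\<close>)
  show ?thesis
    unfolding decomposition
  proof (rule SONC_cone_add_circuit_sum[OF _ square])
    fix ij :: "'n \<times> 'n"
    show "0 \<le> \<mu> ij"
      by (cases ij) (simp add: \<mu>_def l)
    show "\<mu> ij = 0 \<or> h ij = 0 \<or>
        circuit_poly (h ij) \<and> total_degree (h ij) \<le> 2 * D \<and> nonneg_poly (h ij)"
      using pieces by (cases ij) simp
  qed simp
qed

end
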